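(* Let $r,n$ be positive integers with $r\equiv2\pmod4$. Then $$\sum_{\pi\in A_{r,n}}q^{\mathrm{finv}_A(\pi)}=2^{n-1}\prod_{i=1}^n\Bigl[\tfrac r2\cdot i\Bigr]_q.$$
   Context: $G_{r,n}=\mathbb{Z}_r\wr S_n$ is the set of pairs $(\vec z,\tau)$ with $\vec z=(z_1,\dots,z_n)\in\{0,\dots,r-1\}^n$, $\tau\in S_n$, with product $(\vec z,\tau)(\vec z',\tau')=((z_1+z'_{\tau^{-1}(1)},\dots,z_n+z'_{\tau^{-1}(n)}),\tau\circ\tau')$, addition mod $r$. For $\pi=(\vec z,\tau)$: $|\pi|=(\vec0,\tau)$ is identified with $\tau$, $\mathrm{inv}(|\pi|)$ is the usual inversion number of $\tau$, and $c_i(\pi)=z_{\tau(i)}$. The generator $s_0$ is the pair with vector $(1,0,\dots,0)$ and identity permutation; for $1\le i\le n-1$, $s_i$ is the pair with zero vector and transposition $(i\ i+1)$. $A_{r,n}$ is the kernel of the homomorphism $G_{r,n}\to\{\pm1\}$ sending every $s_i$, $0\le i\le n-1$, to $-1$. For a nonnegative integer $a$, $a\oslash 2\in\{0,\dots,\frac r2-1\}$ is the residue modulo $\frac r2$ of $\frac a2$ if $a$ is even, and of $\frac{a+r/2}{2}$ if $a$ is odd. For $\pi\in A_{r,n}$, $\mathrm{finv}_A(\pi)=\frac r2\cdot\mathrm{inv}(|\pi|)+\sum_{i=1}^n(c_i(\pi)\oslash2)$. Here $[k]_q=1+q+\cdots+q^{k-1}$. *)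

theory Defs
  imports "HOL-Algebra.Sym_Groups" "HOL-Computational_Algebra.Polynomial"
begin

type_synonym coloured_perm = "(nat \<Rightarrow> nat) \<times> (nat \<Rightarrow> nat)"

(* Vectors are indexed by {1..n} and, as elements of an extensional function space,
   are undefined elsewhere; permutations of {1..n} fix every other number. *)
definition wreath_group :: "nat \<Rightarrow> nat \<Rightarrow> coloured_perm monoid" where
  "wreath_group r n =
    \<lparr> carrier = ({1..n} \<rightarrow>\<^sub>E {0..<r}) \<times> {\<tau>. \<tau> permutes {1..n}},
      mult = (\<lambda>(z, \<tau>) (z', \<tau>').
                (\<lambda>i\<in>{1..n}. (z i + z' (Hilbert_Choice.inv \<tau> i)) mod r, \<tau> \<circ> \<tau>')),
      one = (\<lambda>i\<in>{1..n}. 0, id) \<rparr>"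

definition generator :: "nat \<Rightarrow> nat \<Rightarrow> coloured_perm" where
  "generator n i =
    (if i = 0 then (\<lambda>j\<in>{1..n}. if j = 1 then 1 else 0, id)
     else (\<lambda>j\<in>{1..n}. 0, transpose i (i + 1)))"

(* The extensionality condition only fixes the value off the carrier, so that the
   homomorphism is unique as a HOL function; see sign_char_ex1 below. *)
definition sign_char :: "nat \<Rightarrow> nat \<Rightarrow> coloured_perm \<Rightarrow> int" where
  "sign_char r n =
    (THE \<phi>. \<phi> \<in> hom (wreath_group r n) sign_img
          \<and> \<phi> \<in> extensional (carrier (wreath_group r n))
          \<and> (\<forall>i<n. \<phi> (generator n i) = -1))"

definition alt_wreath :: "nat \<Rightarrow> nat \<Rightarrow> coloured_perm set" where
  "alt_wreath r n = kernel (wreath_group r n) sign_img (sign_char r n)"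

definition inversions :: "nat \<Rightarrow> (nat \<Rightarrow> nat) \<Rightarrow> nat" where
  "inversions n \<tau> = card {(i, j). 1 \<le> i \<and> i < j \<and> j \<le> n \<and> \<tau> i > \<tau> j}"

definition colour :: "coloured_perm \<Rightarrow> nat \<Rightarrow> nat" where
  "colour \<pi> i = fst \<pi> (snd \<pi> i)"

(* Intended for r congruent to 2 modulo 4: then r div 2 is odd, and both outer
   divisions by 2 are exact. *)
definition half_residue :: "nat \<Rightarrow> nat \<Rightarrow> nat" where
  "half_residue r a =
    (if even a then (a div 2) mod (r div 2) else ((a + r div 2) div 2) mod (r div 2))"

definition finv_A :: "nat \<Rightarrow> nat \<Rightarrow> coloured_perm \<Rightarrow> nat" where
  "finv_A r n \<pi> =
    (r div 2) * inversions n (snd \<pi>) + (\<Sum>i=1..n. half_residue r (colour \<pi> i))"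

abbreviation qvar :: "int poly" where
  "qvar \<equiv> [:0, 1:]"

definition q_bracket :: "nat \<Rightarrow> int poly" where
  "q_bracket k = (\<Sum>i<k. qvar ^ i)"

lemma wreath_group_is_group:
  assumes "r > 0"
  shows "group (wreath_group r n)"
proof (rule groupI)
  fix x y assume "x \<in> carrier (wreath_group r n)" "y \<in> carrier (wreath_group r n)"
  then show "x \<otimes>\<^bsub>wreath_group r n\<^esub> y \<in> carrier (wreath_group r n)"
    using assms by (auto simp: wreath_group_def permutes_compose)
next
  show "\<one>\<^bsub>wreath_group r n\<^esub> \<in> carrier (wreath_group r n)"
    using assms by (auto simp: wreath_group_def permutes_id)
next
  fix x y w assume *: "x \<in> carrier (wreath_group r n)" "y \<in> carrier (wreath_group r n)"
    "w \<in> carrier (wreath_group r n)"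
  obtain a s b t c u where xyw: "x = (a, s)" "y = (b, t)" "w = (c, u)"
    by (metis surj_pair)
  have p: "s permutes {1..n}" "t permutes {1..n}"
    using * xyw by (auto simp: wreath_group_def)
  have i: "Hilbert_Choice.inv (s \<circ> t) = Hilbert_Choice.inv t \<circ> Hilbert_Choice.inv s"
    using p by (simp add: o_inv_distrib permutes_bij)
  have m: "Hilbert_Choice.inv s j \<in> {1..n}" if "j \<in> {1..n}" for j
    using permutes_in_image[OF permutes_inv[OF p(1)]] that by blast
  show "x \<otimes>\<^bsub>wreath_group r n\<^esub> y \<otimes>\<^bsub>wreath_group r n\<^esub> w
      = x \<otimes>\<^bsub>wreath_group r n\<^esub> (y \<otimes>\<^bsub>wreath_group r n\<^esub> w)"
    using m unfolding xyw
    by (auto simp: wreath_group_def i comp_assoc fun_eq_iff restrict_def mod_simps add.assoc)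
next
  fix x assume *: "x \<in> carrier (wreath_group r n)"
  show "\<one>\<^bsub>wreath_group r n\<^esub> \<otimes>\<^bsub>wreath_group r n\<^esub> x = x"
    using * by (force simp: wreath_group_def fun_eq_iff restrict_def PiE_iff extensional_def)
next
  fix x assume *: "x \<in> carrier (wreath_group r n)"
  obtain a s where x: "x = (a, s)" by fastforce
  have s: "s permutes {1..n}" using * x by (auto simp: wreath_group_def)
  define y where "y = (\<lambda>i\<in>{1..n}. (r - a (s i)) mod r, Hilbert_Choice.inv s)"
  have m: "s j \<in> {1..n}" if "j \<in> {1..n}" for j
    using permutes_in_image[OF s] that by blast
  have a: "a j < r" if "j \<in> {1..n}" for j
    using * x that by (auto simp: wreath_group_def PiE_iff)
  have "y \<in> carrier (wreath_group r n)"
    using assms permutes_inv[OF s] by (auto simp: wreath_group_def y_def)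
  moreover have "y \<otimes>\<^bsub>wreath_group r n\<^esub> x = \<one>\<^bsub>wreath_group r n\<^esub>"
    using m a
    by (force simp: wreath_group_def y_def x fun_eq_iff restrict_def permutes_inv_o[OF s]
        permutes_inv_inv[OF s] mod_simps permutes_inverses[OF s] less_imp_le)
  ultimately show "\<exists>y\<in>carrier (wreath_group r n). y \<otimes>\<^bsub>wreath_group r n\<^esub> x = \<one>\<^bsub>wreath_group r n\<^esub>"
    by blast
qed

lemma generator_in_carrier:
  assumes "r \<ge> 2" "i < n"
  shows "generator n i \<in> carrier (wreath_group r n)"
  using assms by (auto simp: generator_def wreath_group_def permutes_id intro!: permutes_swap_id)

lemma sign_char_ex1:
  assumes "r > 0" "even r"
  shows "\<exists>!\<phi>. \<phi> \<in> hom (wreath_group r n) sign_img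
          \<and> \<phi> \<in> extensional (carrier (wreath_group r n))
          \<and> (\<forall>i<n. \<phi> (generator n i) = -1)"
proof (rule ex_ex1I)
  let ?G = "wreath_group r n"
  have r2: "r \<ge> 2" using assms by presburger
  let ?f = "\<lambda>(z :: nat \<Rightarrow> nat, \<tau> :: nat \<Rightarrow> nat). (\<Prod>i\<in>{1..n}. (-1) ^ z i) * sign \<tau> :: int"
  have par: "(-1) ^ (a mod r) = ((-1) ^ a :: int)" for a :: nat
    using assms by (metis dvd_mod_iff neg_one_even_power neg_one_odd_power)
  have gen: "?f (generator n i) = -1" if "i < n" for i
  proof (cases "i = 0")
    case True
    have "(\<Prod>j\<in>{1..n}. (-1) ^ (if j = 1 then 1 else 0)) = (\<Prod>j\<in>{1..n}. if j = 1 then -1 else (1::int))"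
      by (intro prod.cong) auto
    also have "\<dots> = -1" using that by (subst prod.delta) auto
    finally show ?thesis using True by (simp add: generator_def sign_id)
  next
    case False
    then show ?thesis by (simp add: generator_def sign_swap_id)
  qed
  have "(restrict ?f (carrier ?G)) \<in> hom ?G sign_img"
  proof (rule homI)
    fix x assume "x \<in> carrier ?G"
    have "(\<Prod>i\<in>A. (-1) ^ z i) \<in> {-1, 1::int}" if "finite A" for A and z :: "nat \<Rightarrow> nat"
      using that by (induction A) (auto simp: minus_one_power_iff)
    from this[of "{1..n}" "fst x"] show "restrict ?f (carrier ?G) x \<in> carrier sign_img"
      using \<open>x \<in> carrier ?G\<close> by (auto simp: sign_img_def sign_def split: prod.splits)
  next
    fix x y assume xy: "x \<in> carrier ?G" "y \<in> carrier ?G"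
    obtain a s b t where e: "x = (a, s)" "y = (b, t)" by (metis surj_pair)
    have p: "s permutes {1..n}" "t permutes {1..n}"
      using xy e by (auto simp: wreath_group_def)
    have "(\<Prod>i\<in>{1..n}. (-1) ^ b (Hilbert_Choice.inv s i)) = (\<Prod>i\<in>{1..n}. (-1::int) ^ b i)"
      by (rule prod.permute[OF permutes_inv[OF p(1)], symmetric, unfolded comp_def])
    moreover have "sign (s \<circ> t) = sign s * sign t"
      using p by (intro sign_compose) (auto intro: permutation_permutes[THEN iffD2])
    ultimately have "?f (x \<otimes>\<^bsub>?G\<^esub> y) = ?f x * ?f y"
      by (simp add: e wreath_group_def par power_add prod.distrib)
    moreover have "x \<otimes>\<^bsub>?G\<^esub> y \<in> carrier ?G"
      using wreath_group_is_group[OF assms(1)] xy by (simp add: group.is_monoid monoid.m_closed)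
    ultimately show "restrict ?f (carrier ?G) (x \<otimes>\<^bsub>?G\<^esub> y)
        = restrict ?f (carrier ?G) x \<otimes>\<^bsub>sign_img\<^esub> restrict ?f (carrier ?G) y"
      using xy by (simp add: sign_img_def)
  qed
  then show "\<exists>\<phi>. \<phi> \<in> hom ?G sign_img \<and> \<phi> \<in> extensional (carrier ?G)
          \<and> (\<forall>i<n. \<phi> (generator n i) = -1)"
    using gen generator_in_carrier[OF r2]
    by (intro exI[of _ "restrict ?f (carrier ?G)"]) simp
next
  let ?G = "wreath_group r n"
  fix \<phi> \<psi>
  assume P: "\<phi> \<in> hom ?G sign_img \<and> \<phi> \<in> extensional (carrier ?G) \<and> (\<forall>i<n. \<phi> (generator n i) = -1)"
    and Q: "\<psi> \<in> hom ?G sign_img \<and> \<psi> \<in> extensional (carrier ?G) \<and> (\<forall>i<n. \<psi> (generator n i) = -1)"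
  have r2: "r \<ge> 2" using assms by presburger
  interpret G: group ?G by (rule wreath_group_is_group[OF assms(1)])
  define E where "E = {x \<in> carrier ?G. \<phi> x = \<psi> x}"
  have mult: "x \<otimes>\<^bsub>?G\<^esub> y \<in> E" if "x \<in> E" "y \<in> E" for x y
    using that P Q by (auto simp: E_def hom_mult)
  have one: "\<one>\<^bsub>?G\<^esub> \<in> E"
    using P Q hom_one[of \<phi> ?G sign_img] hom_one[of \<psi> ?G sign_img]
    by (simp add: E_def G.is_group sign_img_is_group)
  have gen: "generator n i \<in> E" if "i < n" for i
    using that P Q generator_in_carrier[OF r2 that] by (auto simp: E_def)
  define Z :: "nat \<Rightarrow> nat" where "Z = (\<lambda>i\<in>{1..n}. 0)"
  have mZ: "(Z, s) \<otimes>\<^bsub>?G\<^esub> (Z, t) = (Z, s \<circ> t)" if "s permutes {1..n}" for s t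
    using permutes_in_image[OF permutes_inv[OF that]]
    by (auto simp: wreath_group_def Z_def fun_eq_iff restrict_def)
  have zone: "(Z, id) \<in> E" using one by (simp add: wreath_group_def Z_def)
  have adj: "(Z, transpose i (Suc i)) \<in> E" if "1 \<le> i" "Suc i \<le> n" for i
    using gen[of i] that by (simp add: generator_def Z_def)
  have tr: "(Z, transpose i j) \<in> E" if "1 \<le> i" "i < j" "j \<le> n" for i j
    using that(2,1,3)
  proof (induction rule: strict_inc_induct)
    case (base i) then show ?case using adj[of i] by simp
  next
    case (step i)
    let ?a = "transpose i (Suc i)"
    have pa: "?a permutes {1..n}" and pb: "transpose (Suc i) j permutes {1..n}"
      using step by (auto intro!: permutes_swap_id)
    have "(Z, ?a \<circ> (transpose (Suc i) j \<circ> ?a)) \<in> E"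
      using mult[OF adj[of i] mult[OF step.IH adj[of i]]] step by (simp add: mZ[OF pa] mZ[OF pb])
    moreover have "?a \<circ> (transpose (Suc i) j \<circ> ?a) = transpose i j"
      using step by (auto simp: fun_eq_iff transpose_def)
    ultimately show ?case by simp
  qed
  have perm: "(Z, s) \<in> E" if "s permutes {1..n}" for s
    using finite_atLeastAtMost that
  proof (induction rule: permutes_rev_induct)
    case id then show ?case using zone by (simp add: id_def)
  next
    case (swap a b p)
    have "(Z, transpose a b) \<in> E"
      using tr[of a b] tr[of b a] swap zone by (cases a b rule: linorder_cases) (auto simp: transpose_commute)
    from mult[OF swap.IH this] show ?case using swap
      by (simp add: mZ[OF \<open>p permutes {1..n}\<close>] comp_def)
  qed
  define U :: "nat \<Rightarrow> nat \<Rightarrow> nat" where "U k = (\<lambda>j\<in>{1..n}. if j = k then 1 else 0)" for k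
  have unit: "(U k, id) \<in> E" if "k \<in> {1..n}" for k
  proof -
    let ?t = "transpose 1 k"
    have pt: "?t permutes {1..n}" using that by (auto intro!: permutes_swap_id)
    have "(U 1, id) \<in> E" using gen[of 0] that by (simp add: generator_def U_def)
    from mult[OF mult[OF perm[OF pt] this] perm[OF pt]]
    have "(Z, ?t) \<otimes>\<^bsub>?G\<^esub> (U 1, id) \<otimes>\<^bsub>?G\<^esub> (Z, ?t) \<in> E" .
    moreover have "(Z, ?t) \<otimes>\<^bsub>?G\<^esub> (U 1, id) \<otimes>\<^bsub>?G\<^esub> (Z, ?t) = (U k, id)"
      using that r2 by (auto simp: wreath_group_def Z_def U_def fun_eq_iff restrict_def transpose_def)
    ultimately show ?thesis by simp
  qed
  have vec: "(z, id) \<in> E" if "z \<in> {1..n} \<rightarrow>\<^sub>E {0..<r}" for z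
    using that
  proof (induction "sum z {1..n}" arbitrary: z)
    case 0
    then have "z = Z" by (auto simp: Z_def fun_eq_iff restrict_def PiE_iff extensional_def)
    then show ?case using zone by (simp only:)
  next
    case (Suc m)
    then obtain k where k: "k \<in> {1..n}" "z k > 0"
      by (metis Zero_not_Suc gr0I sum.neutral)
    define y where "y = z(k := z k - 1)"
    have "sum z {1..n} = z k + sum z ({1..n} - {k})" using k by (simp add: sum.remove)
    moreover have "sum y {1..n} = y k + sum y ({1..n} - {k})" using k by (simp add: sum.remove)
    moreover have "sum y ({1..n} - {k}) = sum z ({1..n} - {k})"
      by (intro sum.cong) (auto simp: y_def)
    ultimately have "m = sum y {1..n}" using Suc.hyps(2) k by (simp add: y_def)
    moreover have "y \<in> {1..n} \<rightarrow>\<^sub>E {0..<r}"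
      using Suc.prems k by (auto simp: y_def PiE_iff extensional_def less_imp_diff_less)
    ultimately have "(y, id) \<in> E" using Suc.hyps(1) by blast
    from mult[OF this unit[OF k(1)]] have "(y, id) \<otimes>\<^bsub>?G\<^esub> (U k, id) \<in> E" .
    moreover have "(y, id) \<otimes>\<^bsub>?G\<^esub> (U k, id) = (z, id)"
      using k Suc.prems
      by (auto simp: wreath_group_def y_def U_def fun_eq_iff restrict_def PiE_iff extensional_def)
    ultimately show ?case by simp
  qed
  have "x \<in> E" if x: "x \<in> carrier ?G" for x
  proof -
    obtain z s where e: "x = (z, s)" by fastforce
    then have z: "z \<in> {1..n} \<rightarrow>\<^sub>E {0..<r}" and s: "s permutes {1..n}"
      using x by (auto simp: wreath_group_def)
    have "(z, id) \<otimes>\<^bsub>?G\<^esub> (Z, s) = x"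
      using z by (auto simp: e wreath_group_def Z_def fun_eq_iff restrict_def PiE_iff extensional_def)
    with mult[OF vec[OF z] perm[OF s]] show ?thesis by simp
  qed
  then show "\<phi> = \<psi>" using P Q by (auto simp: E_def intro!: extensionalityI[of _ "carrier ?G"])
qed

end

theory Submission
  imports Defs
begin

text \<open>
  Write \<open>r = 2 * m\<close> with \<open>m\<close> odd. Adding \<open>m\<close> to a colour modulo \<open>r\<close> does not change its half
  residue, so left multiplication by \<open>s\<^sub>0\<^sup>m\<close>, on which the sign character is \<open>(-1)\<^sup>m = -1\<close>,
  preserves the statistic and exchanges the alternating subgroup with its complement. Hence
  twice the required sum is the sum over the whole group, which factors into the inversion
  generating function of the symmetric group in \<open>q\<^sup>m\<close> and the \<open>n\<close>-th power of the sum of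
  \<open>q\<close> to the half residue over all colours. The latter is \<open>2 [m]\<^sub>q\<close>, since the half residue
  takes each value below \<open>m\<close> once on even and once on odd colours. Finally
  \<open>[m]\<^sub>q [i]\<^bsub>q^m\<^esub> = [m i]\<^sub>q\<close>.
\<close>

section \<open>Inversions\<close>

text \<open>For \<open>k\<close> in \<open>{1..n}\<close> this is the cycle k -> n -> n-1 -> ... ->
  k, with inverse \<open>move_back n k\<close>. Composing \<sigma> with it on the right inserts the
  letter \<open>\<sigma> n\<close> at position \<open>k\<close> of the one-line word, pushing later
  letters right.\<close>

definition move_last :: "nat \<Rightarrow> nat \<Rightarrow> nat \<Rightarrow> nat" where
  "move_last n k j = (if j = k then n else if k < j \<and> j \<le> n then j - 1 else j)"

definition move_back :: "nat \<Rightarrow> nat \<Rightarrow> nat \<Rightarrow> nat" where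
  "move_back n k j = (if j = n then k else if k \<le> j \<and> j < n then j + 1 else j)"

lemma move_back_move_last: "k \<le> n \<Longrightarrow> move_back n k (move_last n k j) = j"
  by (auto simp: move_last_def move_back_def)

lemma move_last_move_back: "k \<le> n \<Longrightarrow> move_last n k (move_back n k j) = j"
  by (auto simp: move_last_def move_back_def)

lemma move_last_permutes: "k \<in> {1..n} \<Longrightarrow> move_last n k permutes {1..n}"
  by (rule bij_imp_permutes, rule bij_betw_byWitness[where f' = "move_back n k"])
    (auto simp: move_back_move_last move_last_move_back, auto simp: move_last_def move_back_def)

lemma move_back_permutes: "k \<in> {1..n} \<Longrightarrow> move_back n k permutes {1..n}"
  by (rule bij_imp_permutes, rule bij_betw_byWitness[where f' = "move_last n k"])
    (auto simp: move_back_move_last move_last_move_back, auto simp: move_last_def move_back_def)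

text \<open>Since \<sigma> fixes \<open>Suc n\<close>, the composition inserts the maximal letter at
  position \<open>k\<close>. It is inverted with exactly the \<open>Suc n - k\<close> letters after
  it, and the others keep their relative order.\<close>

lemma inversions_comp_move_last:
  assumes \<sigma>: "\<sigma> permutes {1..n}" and k: "k \<in> {1..Suc n}"
  shows "inversions (Suc n) (\<sigma> \<circ> move_last (Suc n) k) = inversions n \<sigma> + (Suc n - k)"
proof -
  let ?c = "move_last (Suc n) k" and ?d = "move_back (Suc n) k"
  let ?I = "{(i, j). 1 \<le> i \<and> i < j \<and> j \<le> n \<and> \<sigma> i > \<sigma> j}"
  let ?A = "{(i, j). 1 \<le> i \<and> i < j \<and> j \<le> Suc n \<and> (\<sigma> \<circ> ?c) i > (\<sigma> \<circ> ?c) j}"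
  have fin: "finite ?I"
    by (rule finite_subset[of _ "{1..n} \<times> {1..n}"]) auto
  have top: "\<sigma> (Suc n) = Suc n"
    using \<sigma> by (auto simp: permutes_def)
  have le: "\<sigma> i \<le> n" if "1 \<le> i" "i \<le> n" for i
    using permutes_in_image[OF \<sigma>, of i] that by auto
  \<comment> \<open>The inversions of \<sigma> with positions relabelled by \<open>?d\<close>, and
    the pairs whose left end is the inserted letter.\<close>
  have A: "?A = map_prod ?d ?d ` ?I \<union> Pair k ` {k<..Suc n}" (is "_ = ?B")
  proof (intro Set.set_eqI iffI)
    fix x assume x: "x \<in> ?A"
    then obtain i j where ij: "x = (i, j)" "1 \<le> i" "i < j" "j \<le> Suc n" "\<sigma> (?c i) > \<sigma> (?c j)"
      by auto
    show "x \<in> ?B"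
    proof (cases "i = k")
      case True
      then show ?thesis using ij by auto
    next
      case False
      have ci: "1 \<le> ?c i" "?c i \<le> n"
        using False ij k by (auto simp: move_last_def)
      \<comment> \<open>Otherwise the smaller value \<open>\<sigma> (?c j)\<close> would be the
        maximum \<open>Suc n\<close>.\<close>
      have "j \<noteq> k"
        using ij le[OF ci] top by (auto simp: move_last_def)
      then have "(?c i, ?c j) \<in> ?I"
        using ij ci False k by (auto simp: move_last_def split: if_splits)
      moreover have "x = map_prod ?d ?d (?c i, ?c j)"
        using k ij by (simp add: move_back_move_last)
      ultimately show ?thesis by blast
    qed
  next
    fix x assume "x \<in> ?B"
    then show "x \<in> ?A"
    proof
      assume "x \<in> map_prod ?d ?d ` ?I"
      then obtain i j where ij: "x = (?d i, ?d j)" "1 \<le> i" "i < j" "j \<le> n" "\<sigma> i > \<sigma> j"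
        by auto
      then show ?thesis
        using k by (simp add: move_last_move_back) (auto simp: move_back_def)
    next
      assume "x \<in> Pair k ` {k<..Suc n}"
      then obtain j where j: "x = (k, j)" "k < j" "j \<le> Suc n" by auto
      have "\<sigma> (j - 1) \<le> n" using j k by (intro le) auto
      then have "\<sigma> (?c j) < \<sigma> (?c k)"
        using j top by (simp add: move_last_def)
      then show ?thesis using j k by auto
    qed
  qed
  have disj: "map_prod ?d ?d ` ?I \<inter> Pair k ` {k<..Suc n} = {}"
    by (auto simp: move_back_def split: if_splits)
  have "inj ?d"
    using k by (intro inj_on_inverseI[where g = ?c]) (simp add: move_last_move_back)
  then have "inj_on (map_prod ?d ?d) ?I"
    by (meson inj_on_subset map_prod_inj_on subset_UNIV prod.inj_map)
  then show ?thesis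
    unfolding inversions_def A using fin disj
    by (simp add: card_Un_disjoint card_image inj_on_def)
qed

text \<open>Each permutation of \<open>{1..Suc n}\<close> arises exactly once by inserting
  \<open>Suc n\<close> into one of \<open>{1..n}\<close>, and the positions contribute each exponent
  from 0 to \<open>n\<close> once.\<close>

lemma sum_inversions_Suc:
  fixes x :: "'a::comm_semiring_1"
  shows "(\<Sum>\<tau> | \<tau> permutes {1..Suc n}. x ^ inversions (Suc n) \<tau>)
       = (\<Sum>\<sigma> | \<sigma> permutes {1..n}. x ^ inversions n \<sigma>) * (\<Sum>j<Suc n. x ^ j)"
proof -
  let ?N = "Suc n"
  let ?P = "\<lambda>n. {\<sigma>. \<sigma> permutes {1..n::nat}}"
  \<comment> \<open>The position of the maximal letter; moving that letter to the end leaves a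
    permutation fixing \<open>Suc n\<close>.\<close>
  let ?k = "\<lambda>\<tau>. Hilbert_Choice.inv \<tau> ?N"
  have "(\<Sum>\<tau>\<in>?P ?N. x ^ inversions ?N \<tau>)
      = (\<Sum>(\<sigma>, k)\<in>?P n \<times> {1..?N}. x ^ (inversions n \<sigma> + (?N - k)))"
  proof (rule sum.reindex_bij_witness[
      where i = "\<lambda>(\<sigma>, k). \<sigma> \<circ> move_last ?N k" and j = "\<lambda>\<tau>. (\<tau> \<circ> move_back ?N (?k \<tau>), ?k \<tau>)"])
    fix \<tau> assume "\<tau> \<in> ?P ?N"
    then have \<tau>: "\<tau> permutes {1..?N}" by simp
    have k: "?k \<tau> \<in> {1..?N}"
      using permutes_in_image[OF permutes_inv[OF \<tau>], of ?N] by auto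
    then show eq: "(case (\<tau> \<circ> move_back ?N (?k \<tau>), ?k \<tau>) of (\<sigma>, k) \<Rightarrow> \<sigma> \<circ> move_last ?N k) = \<tau>"
      by (simp add: fun_eq_iff move_back_move_last)
    have "\<tau> \<circ> move_back ?N (?k \<tau>) permutes {1..?N}"
      using permutes_compose[OF move_back_permutes[OF k] \<tau>] .
    moreover have "(\<tau> \<circ> move_back ?N (?k \<tau>)) ?N = ?N"
      using permutes_inverses[OF \<tau>] by (simp add: move_back_def)
    ultimately have \<sigma>: "\<tau> \<circ> move_back ?N (?k \<tau>) permutes {1..n}"
      by (elim permutes_superset) (auto simp: le_Suc_eq)
    with k show "(\<tau> \<circ> move_back ?N (?k \<tau>), ?k \<tau>) \<in> ?P n \<times> {1..?N}" by simp
    show "(case (\<tau> \<circ> move_back ?N (?k \<tau>), ?k \<tau>) of (\<sigma>, k) \<Rightarrow> x ^ (inversions n \<sigma> + (?N - k)))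
        = x ^ inversions ?N \<tau>"
      using inversions_comp_move_last[OF \<sigma> k] eq by simp
  next
    fix p assume "p \<in> ?P n \<times> {1..?N}"
    then obtain \<sigma> k where p: "p = (\<sigma>, k)" and \<sigma>: "\<sigma> permutes {1..n}" and k: "k \<in> {1..?N}" by auto
    have \<sigma>': "\<sigma> permutes {1..?N}"
      using \<sigma> by (rule permutes_subset) auto
    have \<tau>: "\<sigma> \<circ> move_last ?N k permutes {1..?N}"
      using permutes_compose[OF move_last_permutes[OF k] \<sigma>'] .
    then show "(case p of (\<sigma>, k) \<Rightarrow> \<sigma> \<circ> move_last ?N k) \<in> ?P ?N"
      by (simp add: p)
    have "\<sigma> ?N = ?N" using \<sigma> by (auto simp: permutes_def)
    then have "?k (\<sigma> \<circ> move_last ?N k) = k"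
      unfolding permutes_inv_eq[OF \<tau>] by (simp add: move_last_def)
    then show "((case p of (\<sigma>, k) \<Rightarrow> \<sigma> \<circ> move_last ?N k)
          \<circ> move_back ?N (?k (case p of (\<sigma>, k) \<Rightarrow> \<sigma> \<circ> move_last ?N k)),
        ?k (case p of (\<sigma>, k) \<Rightarrow> \<sigma> \<circ> move_last ?N k)) = p"
      using k by (simp add: p fun_eq_iff move_last_move_back)
  qed
  also have "\<dots> = (\<Sum>\<sigma>\<in>?P n. x ^ inversions n \<sigma>) * (\<Sum>k\<in>{1..?N}. x ^ (?N - k))"
    by (simp only: sum_product sum.cartesian_product power_add)
  also have "(\<Sum>k\<in>{1..?N}. x ^ (?N - k)) = (\<Sum>j<?N. x ^ j)"
    by (rule sum.reindex_bij_witness[where i = "\<lambda>j. ?N - j" and j = "\<lambda>k. ?N - k"]) auto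
  finally show ?thesis .
qed

text \<open>Rodrigues' product formula: the factor for \<open>i\<close> records where the letter
  \<open>i\<close> is inserted among the smaller ones.\<close>

lemma sum_inversions:
  fixes x :: "'a::comm_semiring_1"
  shows "(\<Sum>\<tau> | \<tau> permutes {1..n}. x ^ inversions n \<tau>) = (\<Prod>i=1..n. \<Sum>j<i. x ^ j)"
proof (induction n)
  case 0
  have empty: "{(i, j). 1 \<le> i \<and> i < j \<and> j \<le> 0 \<and> \<tau> i > \<tau> j} = {}" for \<tau> :: "nat \<Rightarrow> nat"
    by auto
  have "inversions 0 \<tau> = 0" for \<tau>
    unfolding inversions_def empty by simp
  then show ?case by simp
next
  case (Suc n)
  then show ?case unfolding sum_inversions_Suc by simp
qed

section \<open>Half residues\<close>

text \<open>As \<open>r div 2\<close> is odd, the shift swaps parities. An odd colour is halved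
  after adding \<open>r div 2\<close>, so at an even number congruent to its shift modulo
  \<open>r\<close>; halves of even numbers congruent modulo \<open>r\<close> agree modulo
  \<open>r div 2\<close>.\<close>

lemma half_residue_shift:
  assumes "r mod 4 = 2" "a < r"
  shows "half_residue r ((a + r div 2) mod r) = half_residue r a"
proof -
  define m where "m = r div 2"
  have r: "r = 2 * m" and m: "odd m"
    using assms by (presburger add: m_def, simp add: m_def) presburger
  show ?thesis
  \<comment> \<open>The cases are whether the shift wraps around modulo \<open>r\<close>. If it
    does, \<open>a = b + m\<close> goes to \<open>b\<close>, the first case read backwards.\<close>
  proof (cases "a < m")
    case True
    have "(a + m + m) div 2 = a div 2 + m" by simp
    with True m show ?thesis
      by (auto simp: half_residue_def r)
  next
    case False
    then obtain b where b: "a = b + m" by (metis add.commute le_Suc_ex not_less)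
    have "(b + m + m) div 2 = b div 2 + m" by simp
    moreover have "(b + m + m) mod (2 * m) = b"
      using assms r b by (simp add: mult_2 add.assoc)
    ultimately show ?thesis
      using m b by (auto simp: half_residue_def r)
  qed
qed

text \<open>The even colour \<open>2 * b\<close> has half residue \<open>b\<close>; the shift by
  \<open>r div 2\<close> matches odd with even colours and preserves half residues.\<close>

lemma sum_half_residue:
  fixes f :: "nat \<Rightarrow> 'a::comm_semiring_1"
  assumes "r mod 4 = 2"
  shows "(\<Sum>a<r. f (half_residue r a)) = 2 * (\<Sum>b<r div 2. f b)"
proof -
  define m where "m = r div 2"
  have r: "r = 2 * m" and m: "odd m"
    using assms by (presburger add: m_def, simp add: m_def) presburger
  let ?E = "{a. a < r \<and> even a}" and ?O = "{a. a < r \<and> odd a}"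
  let ?s = "\<lambda>a. (a + m) mod r"
  have par: "even (a mod r) = even a" for a
    using r by (simp add: dvd_mod_iff)
  have invol: "?s (?s a) = a" if "a < r" for a
    using that by (simp add: mod_simps r mult_2 add.assoc)
  have even: "(\<Sum>a\<in>?E. f (half_residue r a)) = (\<Sum>b<m. f b)"
    by (rule sum.reindex_bij_witness[where i = "\<lambda>b. 2 * b" and j = "\<lambda>a. a div 2"])
      (auto simp: r half_residue_def)
  have "(\<Sum>a\<in>?O. f (half_residue r a)) = (\<Sum>a\<in>?E. f (half_residue r a))"
    using half_residue_shift[OF assms] m par invol
    by (intro sum.reindex_bij_witness[where i = ?s and j = ?s]) (auto simp: m_def)
  moreover have "(\<Sum>a<r. f (half_residue r a))
      = (\<Sum>a\<in>?E. f (half_residue r a)) + (\<Sum>a\<in>?O. f (half_residue r a))"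
    by (subst sum.union_disjoint[symmetric]) (auto intro!: sum.cong)
  ultimately show ?thesis
    using even by (simp add: m_def mult_2)
qed

section \<open>The alternating subgroup\<close>

lemma finite_carrier_wreath_group: "finite (carrier (wreath_group r n))"
  by (auto simp: wreath_group_def intro!: finite_PiE finite_permutations)

lemma sign_char_props:
  assumes "r > 0" "even r"
  shows "sign_char r n \<in> hom (wreath_group r n) sign_img"
    and "i < n \<Longrightarrow> sign_char r n (generator n i) = -1"
  using theI'[OF sign_char_ex1[OF assms, of n]] unfolding sign_char_def by auto

text \<open>For \<open>n > 0\<close> and \<open>k < r\<close> this is the power of
  \<open>generator n 0\<close> with exponent \<open>k\<close>.\<close>

definition first_colour :: "nat \<Rightarrow> nat \<Rightarrow> coloured_perm" where
  "first_colour n k = (\<lambda>j\<in>{1..n}. if j = 1 then k else 0, id)"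

lemma first_colour_carrier:
  "k < r \<Longrightarrow> first_colour n k \<in> carrier (wreath_group r n)"
  by (auto simp: first_colour_def wreath_group_def permutes_id)

lemma sign_char_first_colour:
  assumes "even r" "n > 0" "k < r"
  shows "sign_char r n (first_colour n k) = (-1) ^ k"
  using \<open>k < r\<close>
proof (induction k)
  case 0
  have "first_colour n 0 = \<one>\<^bsub>wreath_group r n\<^esub>"
    by (simp add: first_colour_def wreath_group_def restrict_def fun_eq_iff)
  then show ?case
    using hom_one[OF sign_char_props(1)] wreath_group_is_group assms sign_img_is_group
    by (simp add: sign_img_def)
next
  case (Suc k)
  have r: "r > 0" "r \<ge> 2" using Suc.prems assms(1) by presburger+
  let ?G = "wreath_group r n"
  \<comment> \<open>No reduction modulo \<open>r\<close> occurs because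
    \<open>Suc k < r\<close>.\<close>
  have "first_colour n (Suc k) = generator n 0 \<otimes>\<^bsub>?G\<^esub> first_colour n k"
    using Suc.prems by (auto simp: first_colour_def generator_def wreath_group_def fun_eq_iff)
  then show ?case
    using hom_mult[OF sign_char_props(1)[OF r(1) assms(1)] generator_in_carrier[OF r(2) assms(2)]
        first_colour_carrier[of k r n]] Suc
      sign_char_props(2)[OF r(1) assms(1,2)]
    by (simp add: sign_img_def)
qed

lemma first_colour_mult:
  assumes "(z, \<tau>) \<in> carrier (wreath_group r n)" "n > 0"
  shows "first_colour n k \<otimes>\<^bsub>wreath_group r n\<^esub> (z, \<tau>) = (z(1 := (z 1 + k) mod r), \<tau>)"
  using assms
  by (auto simp: first_colour_def wreath_group_def fun_eq_iff PiE_iff extensional_def add.commute)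

text \<open>Colours are the entries of \<open>z\<close> read in the order given by \<tau>, which the
  sum forgets. This decouples the colour part of the statistic from \<tau>.\<close>

lemma sum_half_residue_colour:
  assumes "(z, \<tau>) \<in> carrier (wreath_group r n)"
  shows "(\<Sum>i=1..n. half_residue r (colour (z, \<tau>) i)) = (\<Sum>i=1..n. half_residue r (z i))"
  using assms sum.permute[of \<tau> "{1..n}" "\<lambda>i. half_residue r (z i)"]
  by (simp add: wreath_group_def colour_def comp_def)

lemma finv_A_first_colour_mult:
  assumes "r mod 4 = 2" "n > 0" and x: "x \<in> carrier (wreath_group r n)"
  shows "finv_A r n (first_colour n (r div 2) \<otimes>\<^bsub>wreath_group r n\<^esub> x) = finv_A r n x"
proof -
  obtain z \<tau> where e: "x = (z, \<tau>)" by fastforce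
  let ?G = "wreath_group r n" and ?y = "z(1 := (z 1 + r div 2) mod r)"
  have r: "r > 0" "r div 2 < r" using assms(1) by presburger+
  interpret G: group ?G by (rule wreath_group_is_group[OF r(1)])
  have mult: "first_colour n (r div 2) \<otimes>\<^bsub>?G\<^esub> x = (?y, \<tau>)"
    using first_colour_mult x assms(2) by (simp add: e)
  then have y: "(?y, \<tau>) \<in> carrier ?G"
    using G.m_closed[OF first_colour_carrier[OF r(2)] x] by metis
  have "z 1 < r" using x assms(2) by (auto simp: e wreath_group_def PiE_iff)
  then have "half_residue r (?y i) = half_residue r (z i)" for i
    using half_residue_shift[OF assms(1)] by simp
  then show ?thesis
    unfolding mult unfolding e finv_A_def sum_half_residue_colour[OF y]
      sum_half_residue_colour[OF x[unfolded e]] by simp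
qed

text \<open>The factor 2 stays on the left because a semiring offers no halving.\<close>

lemma sum_alt_wreath:
  fixes f :: "nat \<Rightarrow> 'a::comm_semiring_1"
  assumes r: "r mod 4 = 2" and n: "n > 0"
  shows "2 * (\<Sum>\<pi>\<in>alt_wreath r n. f (finv_A r n \<pi>))
       = (\<Sum>\<pi>\<in>carrier (wreath_group r n). f (finv_A r n \<pi>))"
proof -
  let ?G = "wreath_group r n" and ?\<chi> = "sign_char r n" and ?u = "first_colour n (r div 2)"
  let ?A = "{\<pi> \<in> carrier ?G. ?\<chi> \<pi> = 1}" and ?B = "{\<pi> \<in> carrier ?G. ?\<chi> \<pi> = -1}"
  let ?g = "\<lambda>\<pi>. f (finv_A r n \<pi>)"
  have r': "r > 0" "even r" "r div 2 < r" "odd (r div 2)" using r by presburger+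
  interpret G: group ?G by (rule wreath_group_is_group[OF r'(1)])
  have u: "?u \<in> carrier ?G" by (rule first_colour_carrier[OF r'(3)])
  have alt: "alt_wreath r n = ?A"
    by (simp add: alt_wreath_def kernel_def sign_img_def)
  have val: "?\<chi> \<pi> = 1 \<or> ?\<chi> \<pi> = -1" if "\<pi> \<in> carrier ?G" for \<pi>
    using hom_in_carrier[OF sign_char_props(1)[OF r'(1,2)] that] by (auto simp: sign_img_def)
  have neg: "?\<chi> (?u \<otimes>\<^bsub>?G\<^esub> \<pi>) = - ?\<chi> \<pi>" if "\<pi> \<in> carrier ?G" for \<pi>
    using hom_mult[OF sign_char_props(1)[OF r'(1,2)] u that]
      sign_char_first_colour[OF r'(2) n r'(3)] r'(4) by (simp add: sign_img_def)
  have invol: "?u \<otimes>\<^bsub>?G\<^esub> (?u \<otimes>\<^bsub>?G\<^esub> \<pi>) = \<pi>" if "\<pi> \<in> carrier ?G" for \<pi>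
  proof -
    have half: "(r div 2 + r div 2) mod r = 0"
      using r'(2) by (metis dvd_mult_div_cancel mod_self mult_2)
    have "?u \<otimes>\<^bsub>?G\<^esub> ?u = \<one>\<^bsub>?G\<^esub>"
      using half by (auto simp: first_colour_def wreath_group_def fun_eq_iff)
    then show ?thesis
      using u that by (metis G.l_one G.m_assoc)
  qed
  \<comment> \<open>Multiplication by \<open>?u\<close> is its own inverse, swaps the two signs and
    preserves the statistic.\<close>
  have "sum ?g ?A = sum ?g ?B"
    using u neg invol finv_A_first_colour_mult[OF r n]
    by (intro sum.reindex_bij_witness[where i = "\<lambda>\<pi>. ?u \<otimes>\<^bsub>?G\<^esub> \<pi>" and j = "\<lambda>\<pi>. ?u \<otimes>\<^bsub>?G\<^esub> \<pi>"]) auto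
  moreover have "carrier ?G = ?A \<union> ?B" using val by auto
  moreover have "sum ?g (?A \<union> ?B) = sum ?g ?A + sum ?g ?B"
    using finite_carrier_wreath_group[of r n] by (intro sum.union_disjoint) auto
  ultimately show ?thesis by (simp only: alt mult_2)
qed

text \<open>The exponent is a sum of one term for \<tau> and one for each entry of \<open>z\<close>,
  and the carrier is a full product, so the sum factors.\<close>

lemma sum_wreath_group:
  fixes x :: "'a::comm_semiring_1"
  shows "(\<Sum>\<pi>\<in>carrier (wreath_group r n). x ^ finv_A r n \<pi>)
       = (\<Sum>a<r. x ^ half_residue r a) ^ n * (\<Prod>i=1..n. \<Sum>j<i. (x ^ (r div 2)) ^ j)"
proof -
  let ?Z = "{1..n} \<rightarrow>\<^sub>E {0..<r}" and ?P = "{\<tau>. \<tau> permutes {1..n}}"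
  have "(\<Sum>\<pi>\<in>carrier (wreath_group r n). x ^ finv_A r n \<pi>)
      = (\<Sum>(z, \<tau>)\<in>?Z \<times> ?P. (\<Prod>i\<in>{1..n}. x ^ half_residue r (z i)) * (x ^ (r div 2)) ^ inversions n \<tau>)"
  proof (rule sum.cong)
    show "carrier (wreath_group r n) = ?Z \<times> ?P" by (simp add: wreath_group_def)
    fix p assume p: "p \<in> ?Z \<times> ?P"
    obtain z \<tau> where e: "p = (z, \<tau>)" by fastforce
    then have "(z, \<tau>) \<in> carrier (wreath_group r n)" using p by (simp add: wreath_group_def)
    from sum_half_residue_colour[OF this]
    show "x ^ finv_A r n p = (case p of (z, \<tau>) \<Rightarrow>
        (\<Prod>i\<in>{1..n}. x ^ half_residue r (z i)) * (x ^ (r div 2)) ^ inversions n \<tau>)"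
      by (simp add: e finv_A_def power_add power_mult power_sum) (rule mult.commute)
  qed
  also have "\<dots> = (\<Sum>z\<in>?Z. \<Prod>i\<in>{1..n}. x ^ half_residue r (z i))
      * (\<Sum>\<tau>\<in>?P. (x ^ (r div 2)) ^ inversions n \<tau>)"
    by (simp only: sum_product sum.cartesian_product)
  also have "(\<Sum>z\<in>?Z. \<Prod>i\<in>{1..n}. x ^ half_residue r (z i)) = (\<Sum>a<r. x ^ half_residue r a) ^ n"
    by (subst prod_sum_PiE[symmetric]) (simp_all add: atLeast0LessThan)
  finally show ?thesis by (simp only: sum_inversions)
qed

text \<open>The exponents below \<open>m * i\<close> are cut into \<open>i\<close> consecutive
  blocks of length \<open>m\<close>.\<close>

lemma q_bracket_mult:
  "q_bracket (m * i) = q_bracket m * (\<Sum>j<i. (qvar ^ m) ^ j)"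
proof -
  have block: "(\<Sum>k = j * m..<j * m + m. qvar ^ k) = q_bracket m * (qvar ^ m) ^ j" for j
  proof -
    have "(\<Sum>k = j * m..<j * m + m. qvar ^ k) = (\<Sum>k<m. qvar ^ (k + j * m))"
      using sum.shift_bounds_nat_ivl[of "\<lambda>k. qvar ^ k" 0 "j * m" m]
      by (simp only: add_0 add.commute[of m] atLeast0LessThan)
    also have "\<dots> = (\<Sum>k<m. qvar ^ k * (qvar ^ m) ^ j)"
      by (rule sum.cong) (simp_all only: power_add power_mult mult.commute[of j])
    finally show ?thesis by (simp only: q_bracket_def sum_distrib_right)
  qed
  have "q_bracket (m * i) = (\<Sum>j<i. \<Sum>k = j * m..<j * m + m. qvar ^ k)"
    unfolding q_bracket_def sum.nat_group by (simp only: mult.commute[of m i])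
  then show ?thesis
    by (simp only: block sum_distrib_left)
qed

theorem theorem7p6:
  fixes r n :: nat
  assumes "r > 0" and "n > 0" and "r mod 4 = 2"
  shows "(\<Sum>\<pi>\<in>alt_wreath r n. qvar ^ finv_A r n \<pi>)
       = 2 ^ (n - 1) * (\<Prod>i=1..n. q_bracket ((r div 2) * i))"
proof -
  let ?S = "\<Sum>\<pi>\<in>alt_wreath r n. qvar ^ finv_A r n \<pi>" and ?m = "r div 2"
  have "2 * ?S = (2 * q_bracket ?m) ^ n * (\<Prod>i=1..n. \<Sum>j<i. (qvar ^ ?m) ^ j)"
    using sum_alt_wreath[OF assms(3,2), of "\<lambda>k. qvar ^ k"]
    unfolding sum_wreath_group sum_half_residue[OF assms(3)] q_bracket_def .
  \<comment> \<open>Each of the \<open>n\<close> factors of the product absorbs one copy of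
    \<open>q_bracket ?m\<close>.\<close>
  also have "\<dots> = 2 ^ n * (\<Prod>i=1..n. q_bracket (?m * i))"
    by (simp add: q_bracket_mult prod.distrib power_mult_distrib mult.assoc)
  \<comment> \<open>As \<open>n > 0\<close>, a factor 2 splits off; it is then cancelled among
    integer polynomials.\<close>
  also have "\<dots> = 2 * (2 ^ (n - 1) * (\<Prod>i=1..n. q_bracket (?m * i)))"
    using assms(2) by (simp add: power_eq_if mult.assoc)
  finally show ?thesis by simp
qed

end
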